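(* Let $\eta\in(0,\infty)$. Let $X$ be a metrizable, $\sigma$-compact, locally compact Hausdorff space, and let $A$ be a proper retract of $X$. If $d\in\mathrm{Met}(A)$ is a proper metric, then there exists a proper metric $D\in \mathrm{Met}(X)$ such that $D|_{A^{2}}=d$ and $A$ is $\eta$-dense in $(X,D)$.
   Context: For a metrizable space $X$, $\mathrm{Met}(X)$ denotes the set of all metrics on $X$ (with values in $[0,\infty)$) that generate the given topology of $X$. A metric is proper if all bounded closed subsets are compact. A map between topological spaces is proper if inverse images of compact sets are compact. A subset $A$ of $X$ is a proper retract if there is a continuous proper map $r\colon X\to A$ with $r(a)=a$ for all $a\in A$. For a metric space $(Z,h)$ and $\eta\in(0,\infty)$, a subset $E$ of $Z$ is $\eta$-dense in $(Z,h)$ if for every $x\in Z$ there exists $y\in E$ with $h(x,y)\le\eta$. A space is $\sigma$-compact if it is a countable union of compact subspaces, and locally compact if every point has a compact neighborhood. *)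

theory Defs
  imports "HOL-Analysis.Analysis"
begin

text \<open>Only the values of a metric on the carrier matter. As everywhere in the library, the locale
  \<^locale>\<open>Metric_space\<close> also asks for nonnegativity and symmetry off the carrier, where values
  may be set to zero.\<close>

definition Met :: "'a topology \<Rightarrow> ('a \<Rightarrow> 'a \<Rightarrow> real) set" where
  "Met X = {d. Metric_space (topspace X) d \<and> Metric_space.mtopology (topspace X) d = X}"

definition proper_metric :: "'a set \<Rightarrow> ('a \<Rightarrow> 'a \<Rightarrow> real) \<Rightarrow> bool" where
  "proper_metric M d \<longleftrightarrow>
     Metric_space M d \<and>
     (\<forall>S. closedin (Metric_space.mtopology M d) S \<and> Metric_space.mbounded M d S
          \<longrightarrow> compactin (Metric_space.mtopology M d) S)"

text \<open>Not the library's \<^const>\<open>proper_map\<close>, which means closed with compact fibres.\<close>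

definition compact_preimage_map :: "'a topology \<Rightarrow> 'b topology \<Rightarrow> ('a \<Rightarrow> 'b) \<Rightarrow> bool" where
  "compact_preimage_map X Y f \<longleftrightarrow>
     f \<in> topspace X \<rightarrow> topspace Y \<and>
     (\<forall>K. compactin Y K \<longrightarrow> compactin X {x \<in> topspace X. f x \<in> K})"

definition proper_retract_of :: "'a set \<Rightarrow> 'a topology \<Rightarrow> bool" where
  "proper_retract_of A X \<longleftrightarrow>
     A \<subseteq> topspace X \<and>
     (\<exists>r. continuous_map X (subtopology X A) r \<and>
          compact_preimage_map X (subtopology X A) r \<and>
          (\<forall>a\<in>A. r a = a))"

definition dense_within :: "real \<Rightarrow> 'a set \<Rightarrow> ('a \<Rightarrow> 'a \<Rightarrow> real) \<Rightarrow> 'a set \<Rightarrow> bool" where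
  "dense_within \<eta> Z h E \<longleftrightarrow> E \<subseteq> Z \<and> (\<forall>x\<in>Z. \<exists>y\<in>E. h x y \<le> \<eta>)"

definition sigma_compact_space :: "'a topology \<Rightarrow> bool" where
  "sigma_compact_space X \<longleftrightarrow>
     (\<exists>\<K>. countable \<K> \<and> (\<forall>K\<in>\<K>. compactin X K) \<and> \<Union>\<K> = topspace X)"

end

theory Submission
  imports Defs
begin

text \<open>Let \<open>r\<close> be a proper retraction onto \<open>A\<close>, let \<open>\<rho>\<close> metrize \<open>X\<close> and put \<open>f x = \<rho> x (r x)\<close>, which
  vanishes exactly on \<open>A\<close>. Then \<open>e x y = min (\<rho> x y + \<bar>f x - f y\<bar>) (f x + f y)\<close> is a continuous
  pseudometric on \<open>X\<close> that collapses \<open>A\<close> to a point and nothing else, and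
  \<open>D x y = d (r x) (r y) + min \<eta> (e x y)\<close> is the required metric. Balls of \<open>D\<close> lie in preimages
  under \<open>r\<close> of balls of \<open>d\<close>, so they are compact in \<open>X\<close>; a continuous metric with compact balls
  generates the topology and is proper.\<close>

text \<open>Continuity of each \<open>D x\<close> makes every \<open>D\<close>-open set open in
  \<open>X\<close>. Conversely, a set closed in \<open>X\<close> meets a closed
  \<open>D\<close>-ball in an \<open>X\<close>-compact set, whose image under the continuous
  identity is compact in the Hausdorff space \<open>D.mtopology\<close>, hence closed there.\<close>

lemma continuous_metric_with_compact_balls:
  fixes X :: "'a topology" and D :: "'a \<Rightarrow> 'a \<Rightarrow> real"
  assumes "Metric_space (topspace X) D"
    and cont: "\<And>x. x \<in> topspace X \<Longrightarrow> continuous_map X euclideanreal (D x)"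
    and compact: "\<And>x B. x \<in> topspace X \<Longrightarrow> compactin X {y \<in> topspace X. D x y \<le> B}"
  shows "D \<in> Met X" and "proper_metric (topspace X) D"
proof -
  interpret D: Metric_space "topspace X" D by fact
  have open_in_X: "openin X U" if U: "openin D.mtopology U" for U
  proof (subst openin_subopen, intro ballI)
    fix x assume "x \<in> U"
    with U obtain e where e: "e > 0" "D.mball x e \<subseteq> U" and x: "x \<in> topspace X"
      unfolding D.openin_mtopology by blast
    have "D.mball x e = {y \<in> topspace X. D x y \<in> {..<e}}"
      using x by auto
    moreover have "openin X {y \<in> topspace X. D x y \<in> {..<e}}"
      by (rule openin_continuous_map_preimage[OF cont[OF x]]) auto
    ultimately show "\<exists>T. openin X T \<and> x \<in> T \<and> T \<subseteq> U"
      using e x by (intro exI[of _ "D.mball x e"]) auto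
  qed
  have id: "continuous_map X D.mtopology (\<lambda>x. x)"
    unfolding continuous_map_def
  proof (intro conjI allI impI)
    fix U assume U: "openin D.mtopology U"
    then have "{x \<in> topspace X. x \<in> U} = U"
      using openin_subset by fastforce
    with open_in_X[OF U] show "openin X {x \<in> topspace X. x \<in> U}" by simp
  qed auto
  have closed: "closedin D.mtopology C" if C: "closedin X C" for C
    unfolding D.closedin_metric
  proof (intro conjI allI impI)
    show "C \<subseteq> topspace X" using C by (rule closedin_subset)
  next
    fix x assume x: "x \<in> topspace X - C"
    let ?K = "C \<inter> {y \<in> topspace X. D x y \<le> 1}"
    have "compactin X ?K"
      using x by (intro closed_Int_compactin C compact) auto
    then have "compactin D.mtopology ?K"
      using image_compactin[OF _ id] by auto
    then have "closedin D.mtopology ?K"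
      using D.Hausdorff_space_mtopology compactin_imp_closedin by blast
    then obtain e where "e > 0" and "disjnt ?K (D.mball x e)"
      using x unfolding D.closedin_metric by blast
    \<comment> \<open>Within distance 1 of \<open>x\<close> the sets \<open>C\<close> and
      \<open>?K\<close> agree, so a ball of radius at most 1 that misses \<open>?K\<close> misses
      \<open>C\<close>.\<close>
    then have "disjnt C (D.mball x (min e 1))" and "min e 1 > 0"
      by (auto simp: disjnt_iff)
    then show "\<exists>e>0. disjnt C (D.mball x e)" by blast
  qed
  have eq: "D.mtopology = X"
  proof (rule topology_eq[THEN iffD2], intro allI iffI)
    fix U assume "openin X U"
    then have "closedin D.mtopology (topspace X - U)" and "U \<subseteq> topspace X"
      using closed openin_subset by blast+
    then show "openin D.mtopology U"
      by (simp add: openin_closedin_eq)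
  qed (rule open_in_X)
  then show "D \<in> Met X"
    by (simp add: Met_def D.Metric_space_axioms)
  show "proper_metric (topspace X) D"
    unfolding proper_metric_def eq
  proof (intro conjI allI impI)
    fix S assume S: "closedin X S \<and> D.mbounded S"
    then obtain x B where "S \<subseteq> D.mcball x B"
      by (auto simp: D.mbounded_def)
    show "compactin X S"
    proof (cases "S = {}")
      \<comment> \<open>A point of \<open>S\<close> is what forces the centre of
        \<open>D.mcball x B\<close> into the carrier.\<close>
      case False
      with \<open>S \<subseteq> D.mcball x B\<close> have "x \<in> topspace X" and "S \<subseteq> {y \<in> topspace X. D x y \<le> B}"
        by auto
      with S show ?thesis using closed_compactin compact by blast
    qed simp
  qed (rule D.Metric_space_axioms)
qed

theorem theorem4p8:
  fixes X :: "'a topology" and A :: "'a set" and d :: "'a \<Rightarrow> 'a \<Rightarrow> real" and \<eta> :: real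
  assumes "\<eta> > 0"
    and "metrizable_space X" and "sigma_compact_space X"
    and "locally_compact_space X" and "Hausdorff_space X"
    and "proper_retract_of A X"
    and "d \<in> Met (subtopology X A)" and "proper_metric A d"
  shows "\<exists>D \<in> Met X. proper_metric (topspace X) D \<and>
           (\<forall>x\<in>A. \<forall>y\<in>A. D x y = d x y) \<and>
           dense_within \<eta> (topspace X) D A"
proof -
  from \<open>metrizable_space X\<close> obtain M \<rho> where "Metric_space M \<rho>"
    and X_eq: "X = Metric_space.mtopology M \<rho>"
    unfolding metrizable_space_def by blast
  interpret \<rho>: Metric_space M \<rho> by fact
  have M: "topspace X = M" by (simp add: X_eq)
  from \<open>proper_retract_of A X\<close> obtain r where A: "A \<subseteq> M"
    and r_cont: "continuous_map X (subtopology X A) r"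
    and r_proper: "compact_preimage_map X (subtopology X A) r"
    and r_id: "\<And>a. a \<in> A \<Longrightarrow> r a = a"
    unfolding proper_retract_of_def M by blast
  have "topspace (subtopology X A) = A" using A M by auto
  with \<open>d \<in> Met (subtopology X A)\<close> have "Metric_space A d"
    and d_top: "Metric_space.mtopology A d = subtopology X A"
    unfolding Met_def by auto
  interpret d: Metric_space A d by fact
  have r_in: "r x \<in> A" if "x \<in> M" for x
    using continuous_map_image_subset_topspace[OF r_cont] that A M by auto
  define f where "f x = \<rho> x (r x)" for x
  \<comment> \<open>The two terms are a direct route and a route through the collapsed
    \<open>A\<close>. As \<open>r\<close> is merely continuous, \<open>f\<close> need not be
    Lipschitz for \<open>\<rho>\<close>; the summand \<open>\<bar>f x - f y\<bar>\<close> makes it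
    1-Lipschitz for the direct term.\<close>
  define e where "e x y = min (\<rho> x y + \<bar>f x - f y\<bar>) (f x + f y)" for x y
  define D where "D x y = d (r x) (r y) + min \<eta> (e x y)" for x y
  have f_nonneg: "0 \<le> f x" for x by (simp add: f_def)
  have f_zero: "f x = 0 \<longleftrightarrow> x \<in> A" if "x \<in> M" for x
    using that r_in[OF that] r_id A unfolding f_def by (metis \<rho>.zero subsetD)
  have e_nonneg: "0 \<le> e x y" for x y
    by (simp add: e_def f_nonneg)
  have D_zero: "D x y = 0 \<longleftrightarrow> x = y" if "x \<in> M" "y \<in> M" for x y
  proof
    assume "D x y = 0"
    then have "d (r x) (r y) = 0" "e x y = 0"
      using d.nonneg[of "r x" "r y"] e_nonneg[of x y] \<open>\<eta> > 0\<close>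
      unfolding D_def by linarith+
    then have "r x = r y" and "\<rho> x y = 0 \<or> (f x = 0 \<and> f y = 0)"
      using r_in that \<rho>.nonneg[of x y] f_nonneg[of x] f_nonneg[of y]
      unfolding e_def by (simp, linarith)
    \<comment> \<open>If both \<open>f x\<close> and \<open>f y\<close> vanish, both points lie in
      \<open>A\<close> and are fixed by \<open>r\<close>, so \<open>r x = r y\<close> identifies
      them.\<close>
    then show "x = y"
      using that f_zero r_id \<rho>.zero by metis
  next
    assume "x = y"
    then show "D x y = 0"
      using that r_in f_nonneg \<open>\<eta> > 0\<close> by (simp add: D_def e_def)
  qed
  \<comment> \<open>If just one leg, say the second, runs through \<open>A\<close>, the 1-Lipschitz
    bound \<open>f x \<le> \<rho> x y + \<bar>f x - f y\<bar> + f y\<close> gives the claim; if both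
    do, \<open>f y \<ge> 0\<close> suffices.\<close>
  have e_triangle: "e x z \<le> e x y + e y z" if "x \<in> M" "y \<in> M" "z \<in> M" for x y z
    using \<rho>.triangle[OF that] f_nonneg[of y] \<rho>.nonneg[of x y] \<rho>.nonneg[of y z]
    unfolding e_def by linarith
  have "Metric_space M D"
  proof
    show "0 \<le> D x y" for x y
      using e_nonneg[of x y] \<open>\<eta> > 0\<close> by (simp add: D_def)
    show "D x y = D y x" for x y
      by (simp add: D_def e_def d.commute \<rho>.commute abs_minus_commute add.commute)
    show "D x y = 0 \<longleftrightarrow> x = y" if "x \<in> M" "y \<in> M" for x y
      using D_zero that .
    show "D x z \<le> D x y + D y z" if "x \<in> M" "y \<in> M" "z \<in> M" for x y z
      using e_triangle[OF that] d.triangle[of "r x" "r y" "r z"] r_in that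
        e_nonneg[of x y] e_nonneg[of y z] \<open>\<eta> > 0\<close>
      unfolding D_def by (smt (verit))
  qed
  have r_cont_X: "continuous_map X X r"
    using r_cont continuous_map_into_fulltopology by blast
  have f_cont: "continuous_map X euclideanreal f"
    unfolding f_def
    using continuous_map_mdist[of X \<rho>.Self "\<lambda>x. x" r] r_cont_X
    by (simp add: mtopology_of_def X_eq)
  have D_cont: "continuous_map X euclideanreal (D x)" if x: "x \<in> M" for x
  proof -
    have "continuous_map X euclideanreal (\<lambda>y. d (r x) (r y))"
      using continuous_map_mdist[of X d.Self "\<lambda>y. r x" r] r_cont r_in[OF x] A
      by (auto simp: mtopology_of_def d_top M)
    moreover have "continuous_map X euclideanreal (\<lambda>y. \<rho> x y)"
      using continuous_map_mdist[of X \<rho>.Self "\<lambda>y. x" "\<lambda>y. y"] x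
      by (simp add: mtopology_of_def X_eq)
    ultimately show ?thesis
      unfolding D_def e_def by (intro continuous_intros f_cont) auto
  qed
  have ball_compact: "compactin X {y \<in> M. D x y \<le> B}" if x: "x \<in> M" for x B
  proof -
    let ?P = "{y \<in> M. r y \<in> d.mcball (r x) B}"
    have "compactin (subtopology X A) (d.mcball (r x) B)"
      using \<open>proper_metric A d\<close> d.closedin_mcball d.mbounded_mcball
      unfolding proper_metric_def d_top by metis
    then have "compactin X ?P"
      using r_proper unfolding compact_preimage_map_def M by blast
    moreover have "{y \<in> M. D x y \<le> B} \<subseteq> ?P"
    proof
      fix y assume y: "y \<in> {y \<in> M. D x y \<le> B}"
      then show "y \<in> ?P"
        using r_in[OF x] r_in[of y] e_nonneg[of x y] \<open>\<eta> > 0\<close>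
        by (auto simp: D_def min_def split: if_splits)
    qed
    \<comment> \<open>Closedness is needed in \<open>X\<close> itself and comes from continuity of
      \<open>D x\<close>, since \<open>D\<close> is not yet known to generate the topology.\<close>
    moreover have "closedin X {y \<in> M. D x y \<le> B}"
      using closedin_continuous_map_preimage[OF D_cont[OF x], of "{..B}"] by (simp add: M)
    ultimately show ?thesis
      by (rule closed_compactin)
  qed
  have "D \<in> Met X" "proper_metric (topspace X) D"
    by (rule continuous_metric_with_compact_balls;
        use \<open>Metric_space M D\<close> D_cont ball_compact in \<open>simp add: M\<close>)+
  moreover have "D x y = d x y" if "x \<in> A" "y \<in> A" for x y
  proof -
    have "f x = 0" "f y = 0" using that A f_zero by auto
    then show ?thesis using that r_id \<open>\<eta> > 0\<close> by (simp add: D_def e_def)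
  qed
  \<comment> \<open>The nearby point of \<open>A\<close> is \<open>r x\<close>: as
    \<open>r (r x) = r x\<close>, the \<open>d\<close> term vanishes and only the part truncated at
    \<open>\<eta>\<close> remains.\<close>
  moreover have "D x (r x) \<le> \<eta>" if "x \<in> M" for x
    using r_in[OF that] r_id[OF r_in[OF that]] by (simp add: D_def)
  then have "dense_within \<eta> (topspace X) D A"
    using A r_in unfolding dense_within_def M by blast
  ultimately show ?thesis by blast
qed

end
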